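(* Let $\mathcal{S}^{d-1}$ denote the unit sphere in $\mathbb{R}^d$. For any $0 < \varepsilon < 1/8$ and any integer $k \geq 1$ (and any number of points $n$), there exists a dataset $X \subseteq \mathbb{R}^d$ with $n$ points such that every set $\xi \subseteq \mathbb{R}^d$ with $\Phi(\xi, X) \leq \varepsilon \cdot \Delta_k(X)$ satisfies $|\xi| = \Omega\left(\frac{\mathcal{P}(\mathcal{S}^{d-1}, 4\varepsilon) \cdot k \cdot \log n}{\varepsilon}\right)$, where $\Phi$ and $\Delta_k$ are the Euclidean $k$-median cost and optimal cost.
   Context: A dataset is a finite collection of points, possibly with repetitions counted with multiplicity. Euclidean $k$-median: for a finite set of centers $C \subseteq \mathbb{R}^d$, $\Phi(C, X) = \sum_{x \in X} \min_{c \in C} \|x - c\|$, and $\Delta_k(X)$ is the minimum of $\Phi(C, X)$ over all sets $C \subseteq \mathbb{R}^d$ of $k$ centers. For a metric space $(\mathcal{X}, D)$ and $\delta > 0$, a $\delta$-packing set is $S \subseteq \mathcal{X}$ with $D(x, y) \geq \delta$ for all distinct $x, y \in S$; $\mathcal{P}(\mathcal{X}, \delta)$ is the maximum cardinality of such a set. $\mathcal{S}^{d-1}$ carries the Euclidean distance. The $\Omega$ hides only a fixed universal constant.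
   Formalization: For arbitrary n the claim fails (ξ = X has cost 0 and at most n points, while the bound grows with k); it is stated for n at least (P(S^{d-1},4ε)·k/ε)^A with A a universal exponent, and for d ≥ 1 and finite nonempty ξ. *)

theory Defs
  imports "HOL-Analysis.Analysis" "HOL-Library.Multiset"
begin

text \<open>
  The constant hidden in the lower bound must not depend on the dimension, so the
  dimension \<open>d\<close> is a natural number and not a type: \<open>\<real>\<^sup>d\<close> is
  \<^term>\<open>topspace (Euclidean_space d)\<close>, the set of all \<open>x :: nat \<Rightarrow> real\<close> with
  \<open>x i = 0\<close> for \<open>i \<ge> d\<close>.
\<close>

abbreviation rspace :: "nat \<Rightarrow> (nat \<Rightarrow> real) set" where
  "rspace d \<equiv> topspace (Euclidean_space d)"

definition edist :: "nat \<Rightarrow> (nat \<Rightarrow> real) \<Rightarrow> (nat \<Rightarrow> real) \<Rightarrow> real" where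
  "edist d x y = L2_set (\<lambda>i. x i - y i) {..<d}"

definition unit_sphere :: "nat \<Rightarrow> (nat \<Rightarrow> real) set" where
  "unit_sphere d = {x \<in> rspace d. edist d x (\<lambda>_. 0) = 1}"

definition packing_set :: "'a set \<Rightarrow> ('a \<Rightarrow> 'a \<Rightarrow> real) \<Rightarrow> real \<Rightarrow> 'a set \<Rightarrow> bool" where
  "packing_set M D \<delta> S \<longleftrightarrow> S \<subseteq> M \<and> (\<forall>x\<in>S. \<forall>y\<in>S. x \<noteq> y \<longrightarrow> D x y \<ge> \<delta>)"

text \<open>
  Meaningful when the cardinalities of the packing sets are bounded, in particular for
  totally bounded spaces such as spheres; \<^const>\<open>Max\<close> of an infinite set is unspecified.
\<close>

definition packing_number :: "'a set \<Rightarrow> ('a \<Rightarrow> 'a \<Rightarrow> real) \<Rightarrow> real \<Rightarrow> nat" where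
  "packing_number M D \<delta> = Max {card S |S. finite S \<and> packing_set M D \<delta> S}"

text \<open>
  Only meaningful for finite nonempty \<open>C\<close>. Datasets are multisets, so repeated points
  contribute to the sum with their multiplicity.
\<close>

definition kmedian_cost :: "nat \<Rightarrow> (nat \<Rightarrow> real) set \<Rightarrow> (nat \<Rightarrow> real) multiset \<Rightarrow> real" where
  "kmedian_cost d C X = (\<Sum>x\<in>#X. Min ((\<lambda>c. edist d x c) ` C))"

text \<open>
  For \<open>d, k \<ge> 1\<close> the infimum is over a nonempty set bounded below by \<open>0\<close>, and it is attained.
\<close>

definition kmedian_opt :: "nat \<Rightarrow> nat \<Rightarrow> (nat \<Rightarrow> real) multiset \<Rightarrow> real" where
  "kmedian_opt d k X =
     (INF C \<in> {C. C \<subseteq> rspace d \<and> finite C \<and> card C = k}. kmedian_cost d C X)"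

end

theory Submission imports Defs begin

text \<open>
  Take a maximal \<open>4\<epsilon>\<close>-packing \<open>S\<close> of the sphere and put the points \<open>q\<^sup>-\<^sup>j u\<close>
  with \<open>u \<in> S\<close>, \<open>j < M\<close>, \<open>q = 1 + 4\<epsilon>\<close> around each of \<open>k\<close> distant origins, with
  multiplicity about \<open>3 q\<^sup>j\<close>. Every one of these \<open>N = k \<cdot> card S \<cdot> M\<close> sites costs between
  \<open>3\<close> and \<open>4\<close> when served by its origin, hence the optimal cost is at most \<open>4 N\<close>. The balls
  of radius \<open>3/2 \<epsilon> q\<^sup>-\<^sup>j\<close> around the sites are disjoint, and a site whose ball
  contains no centre costs at least \<open>9/2 \<epsilon>\<close>, so at cost \<open>4 \<epsilon> N\<close> at
  least \<open>N / 9\<close> of the balls contain a centre. About \<open>4 N q\<^sup>M\<close> points are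
  needed, which allows \<open>M\<close> of order \<open>ln n / \<epsilon>\<close>; surplus points are put at
  an origin.
\<close>

section \<open>Euclidean distance and packings of the unit sphere\<close>

lemma edist_nonneg [simp]: "0 \<le> edist d x y"
  by (simp add: edist_def)

lemma edist_commute: "edist d x y = edist d y x"
  unfolding edist_def L2_set_def by (simp add: power2_commute)

lemma edist_triangle: "edist d x z \<le> edist d x y + edist d y z"
proof -
  have "edist d x z = L2_set (\<lambda>i. (x i - y i) + (y i - z i)) {..<d}"
    by (simp add: edist_def)
  also have "\<dots> \<le> edist d x y + edist d y z"
    unfolding edist_def by (rule L2_set_triangle_ineq)
  finally show ?thesis .
qed

lemma edist_power2: "(edist d x y)\<^sup>2 = (\<Sum>i<d. (x i - y i)\<^sup>2)"
  by (simp add: edist_def L2_set_def sum_nonneg)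

lemma edist_coordinate_le: "i < d \<Longrightarrow> \<bar>x i - y i\<bar> \<le> edist d x y"
  using member_le_L2_set[of "{..<d}" i "\<lambda>i. \<bar>x i - y i\<bar>"]
  by (simp add: edist_def L2_set_def)

lemma unit_sphere_sum_power2: "u \<in> unit_sphere d \<Longrightarrow> (\<Sum>i<d. (u i)\<^sup>2) = 1"
  using edist_power2[of d u "\<lambda>_. 0"] by (simp add: unit_sphere_def)

lemma edist_add_left: "edist d (\<lambda>i. a i + x i) (\<lambda>i. a i + y i) = edist d x y"
  by (simp add: edist_def)

lemma edist_add_scaled: "0 \<le> r \<Longrightarrow> u \<in> unit_sphere d \<Longrightarrow> edist d (\<lambda>i. a i + r * u i) a = r"
  by (rule power2_eq_imp_eq)
    (simp_all add: edist_power2 power_mult_distrib unit_sphere_sum_power2 flip: sum_distrib_left)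

text \<open>For unit vectors the inner product is determined by their distance, so the cross term
  can be traded for \<open>edist d u v\<close>. The squared distance splits into a radial part and
  an angular part, and these are bounded separately in
  \<open>scaled_packing_separated\<close>.\<close>

lemma edist_scaled_power2:
  assumes "u \<in> unit_sphere d" "v \<in> unit_sphere d"
  shows "(edist d (\<lambda>i. r * u i) (\<lambda>i. s * v i))\<^sup>2 = (r - s)\<^sup>2 + r * s * (edist d u v)\<^sup>2"
proof -
  have "(edist d (\<lambda>i. r * u i) (\<lambda>i. s * v i))\<^sup>2 =
      (\<Sum>i<d. (r\<^sup>2 - r * s) * (u i)\<^sup>2 + (s\<^sup>2 - r * s) * (v i)\<^sup>2 + r * s * (u i - v i)\<^sup>2)"
    unfolding edist_power2 by (rule sum.cong) (auto simp: power2_eq_square algebra_simps)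
  also have "\<dots> = (r\<^sup>2 - r * s) + (s\<^sup>2 - r * s) + r * s * (edist d u v)\<^sup>2"
    by (simp add: sum.distrib edist_power2 unit_sphere_sum_power2 assms flip: sum_distrib_left)
  finally show ?thesis by (simp add: power2_eq_square algebra_simps)
qed

text \<open>Points of a packing lie in distinct cells of a sufficiently fine grid.\<close>

lemma unit_sphere_packing_bounded:
  assumes "\<delta> > 0"
  shows "\<exists>B. \<forall>S. packing_set (unit_sphere d) (edist d) \<delta> S \<longrightarrow> card S \<le> B"
proof -
  \<comment> \<open>Grid cells have side \<open>1 / N\<close>. Two points in one cell are at most
    \<open>d / N\<close> apart, so this choice of \<open>N\<close> puts them closer than
    \<open>\<delta>\<close>.\<close>
  obtain N :: nat where N: "real d / \<delta> < real N" using reals_Archimedean2 by blast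
  have N0: "N > 0" using N assms by (cases N) (auto simp: divide_less_0_iff field_simps)
  define g where "g = (\<lambda>x::nat \<Rightarrow> real. restrict (\<lambda>i. \<lfloor>real N * x i\<rfloor>) {..<d})"
  let ?T = "PiE {..<d} (\<lambda>_. {- int N..int N})"
  have "card S \<le> card ?T" if S: "packing_set (unit_sphere d) (edist d) \<delta> S" for S
  proof (rule card_inj_on_le)
    show "finite ?T" by (intro finite_PiE) auto
    show "g ` S \<subseteq> ?T"
    proof (clarsimp simp: g_def PiE_iff extensional_def)
      fix x i assume "x \<in> S" and i: "i < d"
      then have x: "x \<in> unit_sphere d" using S by (auto simp: packing_set_def)
      have "\<bar>x i\<bar> \<le> 1" using edist_coordinate_le[OF i, of x "\<lambda>_. 0"] x
        by (simp add: unit_sphere_def)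
      then have "real N * \<bar>x i\<bar> \<le> real N * 1" by (intro mult_left_mono) auto
      then have *: "\<bar>real N * x i\<bar> \<le> real N" by (simp add: abs_mult)
      show "- int N \<le> \<lfloor>real N * x i\<rfloor> \<and> \<lfloor>real N * x i\<rfloor> \<le> int N"
        using * unfolding le_floor_iff floor_le_iff by simp linarith
    qed
    show "inj_on g S"
    proof (rule inj_onI, rule ccontr)
      fix x y assume xy: "x \<in> S" "y \<in> S" "g x = g y" "x \<noteq> y"
      have "\<bar>x i - y i\<bar> \<le> 1 / real N" if "i < d" for i
      proof -
        have "\<lfloor>real N * x i\<rfloor> = \<lfloor>real N * y i\<rfloor>"
          using fun_cong[OF xy(3), of i] that by (simp add: g_def)
        then have "\<bar>real N * x i - real N * y i\<bar> \<le> 1" by linarith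
        then have "real N * \<bar>x i - y i\<bar> \<le> 1"
          by (metis abs_mult abs_of_nat right_diff_distrib)
        then show ?thesis using N0 by (simp add: field_simps)
      qed
      then have "(\<Sum>i<d. \<bar>x i - y i\<bar>) \<le> (\<Sum>i<d. 1 / real N)" by (intro sum_mono) auto
      moreover have "edist d x y \<le> (\<Sum>i<d. \<bar>x i - y i\<bar>)"
        unfolding edist_def by (rule L2_set_le_sum_abs)
      moreover have "real d / real N < \<delta>" using N N0 assms by (simp add: field_simps)
      moreover have "\<delta> \<le> edist d x y" using S xy by (auto simp: packing_set_def)
      ultimately show False by simp
    qed
  qed
  then show ?thesis by blast
qed

text \<open>The \<open>Max\<close> in \<open>packing_number\<close> is attained because the
  cardinalities are bounded by the grid argument and the set of them is nonempty: the first basis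
  vector, which exists for \<open>1 \<le> d\<close>, is a packing of size 1.\<close>

lemma packing_number_unit_sphere:
  assumes "\<delta> > 0" "1 \<le> d"
  shows "1 \<le> packing_number (unit_sphere d) (edist d) \<delta>"
    and "\<exists>S. finite S \<and> packing_set (unit_sphere d) (edist d) \<delta> S \<and>
           card S = packing_number (unit_sphere d) (edist d) \<delta>"
proof -
  let ?A = "{card S |S. finite S \<and> packing_set (unit_sphere d) (edist d) \<delta> S}"
  obtain B where "\<forall>S. packing_set (unit_sphere d) (edist d) \<delta> S \<longrightarrow> card S \<le> B"
    using unit_sphere_packing_bounded[OF assms(1)] by blast
  then have "?A \<subseteq> {..B}" by auto
  then have fin: "finite ?A" using finite_subset by blast
  let ?e = "\<lambda>i::nat. if i = 0 then 1 else 0 :: real"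
  have "(edist d ?e (\<lambda>_. 0))\<^sup>2 = (\<Sum>i<d. if i = 0 then 1 else 0)"
    unfolding edist_power2 by (rule sum.cong) auto
  then have "(edist d ?e (\<lambda>_. 0))\<^sup>2 = 1\<^sup>2" using assms(2) by simp
  then have "edist d ?e (\<lambda>_. 0) = 1" by (rule power2_eq_imp_eq) auto
  then have "?e \<in> unit_sphere d"
    using assms(2) by (auto simp: unit_sphere_def topspace_Euclidean_space)
  then have "packing_set (unit_sphere d) (edist d) \<delta> {?e}" by (simp add: packing_set_def)
  then have "\<exists>S. card {?e} = card S \<and> finite S \<and> packing_set (unit_sphere d) (edist d) \<delta> S"
    by blast
  then have one: "1 \<in> ?A" by simp
  show "1 \<le> packing_number (unit_sphere d) (edist d) \<delta>"
    unfolding packing_number_def using fin one by (rule Max_ge)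
  have "Max ?A \<in> ?A" using fin one by (intro Max_in) auto
  then show "\<exists>S. finite S \<and> packing_set (unit_sphere d) (edist d) \<delta> S \<and>
           card S = packing_number (unit_sphere d) (edist d) \<delta>"
    unfolding packing_number_def by auto
qed

section \<open>The cost function, and counting centres through disjoint balls\<close>

lemma Min_edist_nonneg: "finite C \<Longrightarrow> C \<noteq> {} \<Longrightarrow> 0 \<le> Min ((\<lambda>c. edist d x c) ` C)"
  by simp

lemma kmedian_cost_nonneg: "finite C \<Longrightarrow> C \<noteq> {} \<Longrightarrow> 0 \<le> kmedian_cost d C X"
  unfolding kmedian_cost_def by (induction X) simp_all

lemma kmedian_cost_add: "kmedian_cost d C (X + Y) = kmedian_cost d C X + kmedian_cost d C Y"
  by (simp add: kmedian_cost_def)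

lemma kmedian_cost_replicate:
  "kmedian_cost d C (replicate_mset w x) = real w * Min ((\<lambda>c. edist d x c) ` C)"
  by (simp add: kmedian_cost_def)

lemma kmedian_cost_sum:
  "kmedian_cost d C (\<Sum>p\<in>I. f p) = (\<Sum>p\<in>I. kmedian_cost d C (f p))"
  by (induction I rule: infinite_finite_induct)
    (auto simp: kmedian_cost_add, simp_all add: kmedian_cost_def)

text \<open>Since \<open>1 \<le> k\<close>, no admissible set of centres is empty. All costs are
  therefore nonnegative, and the infimum lies below each of them.\<close>

lemma kmedian_opt_le:
  assumes "1 \<le> k" "C \<subseteq> rspace d" "finite C" "card C = k"
  shows "kmedian_opt d k X \<le> kmedian_cost d C X"
  unfolding kmedian_opt_def
proof (rule cINF_lower)
  show "bdd_below ((\<lambda>C. kmedian_cost d C X) ` {C. C \<subseteq> rspace d \<and> finite C \<and> card C = k})"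
    by (rule bdd_belowI2[where m = 0]) (use assms(1) in \<open>auto intro!: kmedian_cost_nonneg\<close>)
qed (use assms in auto)

text \<open>The balls of radius \<open>\<rho> p\<close> around the sites \<open>f p\<close> are
  disjoint by \<open>sep\<close>, so a centre lies in at most one of them. A site whose ball is
  missed pays at least \<open>b\<close>, so at most \<open>K / b\<close> balls are missed. The
  additional points \<open>Y\<close> can only raise the cost.\<close>

lemma card_centres_ge:
  fixes w :: "'i \<Rightarrow> nat"
  assumes I: "finite I" and C: "finite C" "C \<noteq> {}" and b: "b > 0"
    and sep: "\<And>p q. p \<in> I \<Longrightarrow> q \<in> I \<Longrightarrow> p \<noteq> q \<Longrightarrow> \<rho> p + \<rho> q \<le> edist d (f p) (f q)"
    and w: "\<And>p. p \<in> I \<Longrightarrow> b \<le> real (w p) * \<rho> p"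
    and cost: "kmedian_cost d C ((\<Sum>p\<in>I. replicate_mset (w p) (f p)) + Y) \<le> K"
  shows "real (card I) - K / b \<le> real (card C)"
proof -
  define G where "G = {p \<in> I. \<exists>c\<in>C. edist d (f p) c < \<rho> p}"
  have GI: "G \<subseteq> I" by (auto simp: G_def)
  then have fG: "finite G" using I finite_subset by blast
  have "\<forall>p\<in>G. \<exists>c. c \<in> C \<and> edist d (f p) c < \<rho> p" by (auto simp: G_def)
  from bchoice[OF this] obtain h
    where h: "\<And>p. p \<in> G \<Longrightarrow> h p \<in> C \<and> edist d (f p) (h p) < \<rho> p" by blast
  have "inj_on h G"
  proof (rule inj_onI, rule ccontr)
    fix p q assume pq: "p \<in> G" "q \<in> G" "h p = h q" "p \<noteq> q"
    have "edist d (f p) (f q) \<le> edist d (f p) (h p) + edist d (f q) (h q)"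
      using edist_triangle[of d "f p" "f q" "h p"] pq(3) by (simp add: edist_commute)
    also have "\<dots> < \<rho> p + \<rho> q" using h[OF pq(1)] h[OF pq(2)] by linarith
    finally show False using sep pq GI by (meson not_le subsetD)
  qed
  then have GC: "card G \<le> card C" using h C by (intro card_inj_on_le[of h]) auto
  have "b * real (card (I - G)) = (\<Sum>p\<in>I - G. b)" by simp
  also have "\<dots> \<le> (\<Sum>p\<in>I - G. real (w p) * Min ((\<lambda>c. edist d (f p) c) ` C))"
  proof (rule sum_mono)
    fix p assume p: "p \<in> I - G"
    then have "\<rho> p \<le> Min ((\<lambda>c. edist d (f p) c) ` C)"
      using C by (auto simp: G_def not_less)
    then show "b \<le> real (w p) * Min ((\<lambda>c. edist d (f p) c) ` C)"
      using w[of p] p by (meson DiffD1 mult_left_mono of_nat_0_le_iff order_trans)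
  qed
  also have "\<dots> \<le> (\<Sum>p\<in>I. real (w p) * Min ((\<lambda>c. edist d (f p) c) ` C))"
    by (rule sum_mono2) (use I Min_edist_nonneg[OF C] in \<open>auto intro!: mult_nonneg_nonneg\<close>)
  also have "\<dots> \<le> K"
    using cost kmedian_cost_nonneg[OF C, of d Y]
    by (simp add: kmedian_cost_add kmedian_cost_sum kmedian_cost_replicate)
  finally have "real (card (I - G)) \<le> K / b" using b by (simp add: field_simps)
  moreover have "card (I - G) = card I - card G" "card G \<le> card I"
    using GI I fG by (auto intro: card_Diff_subset card_mono)
  ultimately show ?thesis using GC by simp
qed

section \<open>Number of radii and separation of the sites\<close>

lemma ln_le_mult_powr_quarter:
  fixes x :: real
  shows "x > 0 \<Longrightarrow> ln x \<le> 4 * x powr (1/4)"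
  using ln_le_minus_one[of "x powr (1/4)"] by (simp add: ln_powr)

text \<open>Here \<open>y\<close> is the number of sites per radius and \<open>m\<close> the number
  of radii. The choice of \<open>m\<close> keeps the growth factor
  \<open>(1 + 4 * \<epsilon>) ^ m\<close> below the square root of \<open>n\<close>. The exponent 8
  gives \<open>y / \<epsilon> \<le> n powr (1/8)\<close>, which is small enough for
  \<open>4 * y * m\<close> to fit into the other square root.\<close>

lemma ring_count_bound:
  fixes y \<epsilon> n :: real
  assumes "0 < \<epsilon>" "\<epsilon> < 1/8" "1 \<le> y" "(y / \<epsilon>) ^ 8 \<le> n"
  defines "m \<equiv> nat \<lfloor>ln n / (8 * \<epsilon>)\<rfloor>"
  shows "ln n / (16 * \<epsilon>) \<le> real m" and "4 * y * real m * (1 + 4 * \<epsilon>) ^ m \<le> n"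
proof -
  define z where "z = y / \<epsilon>"
  have z: "8 \<le> z" using assms(1-3) by (simp add: z_def field_simps)
  have "8 ^ 8 \<le> z ^ 8" using z by (intro power_mono) auto
  then have n8: "8 ^ 8 \<le> n" using assms(4) by (simp add: z_def)
  then have npos: "n > 0" by simp
  have "exp (1::real) \<le> n" using exp_le n8 by simp
  then have ln1: "1 \<le> ln n" using npos by (simp add: ln_ge_iff)
  define x where "x = ln n / (8 * \<epsilon>)"
  have "8 * \<epsilon> < 1" using assms(2) by simp
  with ln1 have x1: "1 \<le> x" using assms(1) by (simp add: x_def field_simps)
  \<comment> \<open>As \<open>x\<close> is at least 1, rounding it down loses at most a factor 2;
    this turns the 8 into 16.\<close>
  then have "1 \<le> \<lfloor>x\<rfloor>" by simp
  then have mx: "real m \<le> x" "x \<le> 2 * real m"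
    unfolding m_def x_def[symmetric] by linarith+
  show "ln n / (16 * \<epsilon>) \<le> real m" using mx(2) by (simp add: x_def)
  have "(1 + 4 * \<epsilon>) ^ m \<le> exp (4 * \<epsilon>) ^ m" using assms(1) by (intro power_mono) auto
  also have "\<dots> = exp (real m * (4 * \<epsilon>))" by (simp add: exp_of_nat_mult)
  also have "\<dots> \<le> exp (x * (4 * \<epsilon>))" using mx(1) assms(1) by simp
  also have "x * (4 * \<epsilon>) = 1/2 * ln n" using assms(1) by (simp add: x_def)
  finally have q: "(1 + 4 * \<epsilon>) ^ m \<le> n powr (1/2)" using npos by (simp add: powr_def)
  have "(z powr 8) powr (1/8) \<le> n powr (1/8)"
    using assms(4) z by (intro powr_mono2) (auto simp: z_def powr_numeral)
  then have zn: "z \<le> n powr (1/8)" using z unfolding powr_powr by simp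
  have "4 * y * real m \<le> 4 * y * x" using mx(1) assms(3) by simp
  also have "\<dots> = z * ln n / 2" using assms(1) by (simp add: x_def z_def field_simps)
  also have "\<dots> \<le> n powr (1/8) * (4 * n powr (1/4)) / 2"
    using zn ln_le_mult_powr_quarter[OF npos] z ln1
    by (intro divide_right_mono mult_mono) auto
  also have "\<dots> = 2 * n powr (3/8)" by (simp flip: powr_add)
  \<comment> \<open>The constant 2 is absorbed because \<open>8 \<le> z\<close> and
    \<open>z \<le> n powr (1/8)\<close>.\<close>
  also have "\<dots> \<le> n powr (1/8) * n powr (3/8)"
    using zn z by (intro mult_right_mono) auto
  also have "\<dots> = n powr (1/2)" by (simp flip: powr_add)
  finally have "4 * y * real m * (1 + 4 * \<epsilon>) ^ m \<le> n powr (1/2) * n powr (1/2)"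
    using q assms(1,3) by (intro mult_mono) auto
  then show "4 * y * real m * (1 + 4 * \<epsilon>) ^ m \<le> n" using npos by (simp flip: powr_add)
qed

text \<open>Equal directions are separated by the gap between the radii, distinct ones by the
  angular term. The factor 3/2 is a compromise: the radial case tolerates factors up to 8/5 when
  \<open>\<epsilon> < 1/8\<close>, while the final count, with weights about \<open>3 / r\<close>,
  needs more than 4/3.\<close>

lemma scaled_packing_separated:
  fixes \<epsilon> r s :: real
  assumes \<epsilon>: "0 < \<epsilon>" "\<epsilon> < 1/8" and S: "packing_set (unit_sphere d) (edist d) (4 * \<epsilon>) S"
    and uv: "u \<in> S" "v \<in> S" and rs: "0 < r" "0 < s"
    and ratio: "u \<noteq> v \<or> (1 + 4 * \<epsilon>) * s \<le> r \<or> (1 + 4 * \<epsilon>) * r \<le> s"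
  shows "3/2 * \<epsilon> * r + 3/2 * \<epsilon> * s \<le> edist d (\<lambda>i. r * u i) (\<lambda>i. s * v i)"
proof (rule power2_le_imp_le)
  have us: "u \<in> unit_sphere d" "v \<in> unit_sphere d" using S uv by (auto simp: packing_set_def)
  have e2: "(edist d (\<lambda>i. r * u i) (\<lambda>i. s * v i))\<^sup>2 = (r - s)\<^sup>2 + r * s * (edist d u v)\<^sup>2"
    by (rule edist_scaled_power2[OF us])
  have lin: "3/2 * \<epsilon> * (a + b) \<le> b - a" if "(1 + 4 * \<epsilon>) * a \<le> b" "0 < a" for a b
  proof -
    \<comment> \<open>The right-hand side is \<open>b - a - 3/2 * \<epsilon> * (a + b)\<close>,
      regrouped into terms that are visibly nonnegative.\<close>
    have "0 \<le> (1 - 3/2 * \<epsilon>) * (b - (1 + 4 * \<epsilon>) * a) + \<epsilon> * a * (1 - 6 * \<epsilon>)"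
      using \<epsilon> that by (intro add_nonneg_nonneg mult_nonneg_nonneg) auto
    then show ?thesis by (simp add: algebra_simps add_divide_distrib)
  qed
  show "(3/2 * \<epsilon> * r + 3/2 * \<epsilon> * s)\<^sup>2 \<le> (edist d (\<lambda>i. r * u i) (\<lambda>i. s * v i))\<^sup>2"
  proof (cases "u = v")
    case True
    with ratio have "3/2 * \<epsilon> * (s + r) \<le> r - s \<or> 3/2 * \<epsilon> * (r + s) \<le> s - r"
      using lin[of s r] lin[of r s] rs by blast
    then have "3/2 * \<epsilon> * (r + s) \<le> \<bar>r - s\<bar>"
      unfolding add.commute[of s r] by linarith
    then have "(3/2 * \<epsilon> * (r + s))\<^sup>2 \<le> \<bar>r - s\<bar>\<^sup>2"
      using \<epsilon> rs by (intro power_mono) auto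
    then show ?thesis
      using rs unfolding e2 by (simp add: distrib_left add_increasing2)
  next
    case False
    then have "4 * \<epsilon> \<le> edist d u v" using S uv by (auto simp: packing_set_def)
    then have "(4 * \<epsilon>)\<^sup>2 \<le> (edist d u v)\<^sup>2" using \<epsilon> by (intro power_mono) auto
    then have 1: "r * s * (16 * \<epsilon>\<^sup>2) \<le> r * s * (edist d u v)\<^sup>2"
      using rs by (intro mult_left_mono) (auto simp: power_mult_distrib)
    have "(3/2 * \<epsilon>)\<^sup>2 \<le> 1\<^sup>2" using \<epsilon> by (intro power_mono) auto
    then have 2: "(3/2 * \<epsilon>)\<^sup>2 * (r - s)\<^sup>2 \<le> 1 * (r - s)\<^sup>2" by (intro mult_right_mono) auto
    have 3: "0 \<le> r * s * \<epsilon>\<^sup>2" using rs by simp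
    \<comment> \<open>This is \<open>(r + s)^2 = (r - s)^2 + 4 * r * s\<close>. The radial terms
      compare by \<open>2\<close>, and the mixed terms because 9 is at most 16.\<close>
    have "(3/2 * \<epsilon> * r + 3/2 * \<epsilon> * s)\<^sup>2 = (3/2 * \<epsilon>)\<^sup>2 * (r - s)\<^sup>2 + 9 * (r * s * \<epsilon>\<^sup>2)"
      by (simp add: power2_eq_square algebra_simps)
    then show ?thesis unfolding e2 using 1 2 3 by linarith
  qed
qed simp

text \<open>Some lower bound on \<open>n\<close> is unavoidable: the support of \<open>X\<close> is
  a set of at most \<open>n\<close> centres with cost 0. The empty \<open>\<xi>\<close> is excluded
  because its cost would be a \<open>Min\<close> over the empty set.\<close>

theorem theorem10:
  "\<exists>c>0. \<exists>A::nat. \<forall>(d::nat) (\<epsilon>::real) (k::nat) (n::nat).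
     1 \<le> d \<and> 0 < \<epsilon> \<and> \<epsilon> < 1/8 \<and> 1 \<le> k \<and>
     (real (packing_number (unit_sphere d) (edist d) (4 * \<epsilon>)) * real k / \<epsilon>) ^ A \<le> real n \<longrightarrow>
     (\<exists>X :: (nat \<Rightarrow> real) multiset. set_mset X \<subseteq> rspace d \<and> size X = n \<and>
        (\<forall>\<xi>. \<xi> \<subseteq> rspace d \<and> finite \<xi> \<and> \<xi> \<noteq> {} \<and>
             kmedian_cost d \<xi> X \<le> \<epsilon> * kmedian_opt d k X \<longrightarrow>
             real (card \<xi>) \<ge>
               c * (real (packing_number (unit_sphere d) (edist d) (4 * \<epsilon>)) * real k * ln (real n) / \<epsilon>)))"
proof (intro exI[of _ "1/144 :: real"] conjI exI[of _ "8 :: nat"] allI impI, goal_cases)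
  case 1
  show ?case by simp
next
  case (2 d \<epsilon> k n)
  define P where "P = packing_number (unit_sphere d) (edist d) (4 * \<epsilon>)"
  have d: "1 \<le> d" and \<epsilon>: "0 < \<epsilon>" "\<epsilon> < 1/8" and k: "1 \<le> k"
    and n: "(real P * real k / \<epsilon>) ^ 8 \<le> real n"
    using 2 by (auto simp: P_def)
  have P1: "1 \<le> P" unfolding P_def by (rule packing_number_unit_sphere) (use \<epsilon> d in auto)
  obtain S where S: "finite S" "packing_set (unit_sphere d) (edist d) (4 * \<epsilon>) S" "card S = P"
    unfolding P_def using packing_number_unit_sphere(2)[of "4 * \<epsilon>" d] \<epsilon> d by auto
  have Ssph: "u \<in> unit_sphere d" if "u \<in> S" for u
    using S(2) that by (auto simp: packing_set_def)
  define y where "y = real P * real k"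
  have y1: "1 \<le> y" using P1 k unfolding y_def
    by (metis mult_mono of_nat_0_le_iff of_nat_1 of_nat_le_iff mult_1 zero_le_one)
  define M where "M = nat \<lfloor>ln (real n) / (8 * \<epsilon>)\<rfloor>"
  define q where "q = 1 + 4 * \<epsilon>"
  have M: "ln (real n) / (16 * \<epsilon>) \<le> real M" "4 * y * real M * q ^ M \<le> real n"
    unfolding M_def q_def by (rule ring_count_bound[OF \<epsilon> y1]; use n in \<open>simp add: y_def\<close>)+
  have q1: "1 < q" using \<epsilon> by (simp add: q_def)
  \<comment> \<open>The origins lie on the first axis at mutual distance at least 10. Sites stay
    within distance 1 of their origin, so sites of different origins are at least 8 apart, whereas
    two of the radii \<open>\<rho>\<close> sum to at most 3.\<close>
  define a :: "nat \<Rightarrow> nat \<Rightarrow> real" where "a = (\<lambda>t i. if i = 0 then 10 * real t else 0)"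
  define r :: "nat \<Rightarrow> real" where "r = (\<lambda>j. 1 / q ^ j)"
  have r: "0 < r j" "r j \<le> 1" for j using q1 by (auto simp: r_def)
  \<comment> \<open>Rounding up adds at most 1, and \<open>r j \<le> 1\<close>, so weight times
    radius stays between 3 and 4.\<close>
  define w where "w = (\<lambda>(t::nat, u::nat \<Rightarrow> real, j). nat \<lceil>3 * q ^ j\<rceil>)"
  define f where "f = (\<lambda>(t, u, j) i. a t i + r j * u i)"
  define \<rho> where "\<rho> = (\<lambda>(t::nat, u::nat \<Rightarrow> real, j). 3/2 * \<epsilon> * r j)"
  define I where "I = {..<k} \<times> S \<times> {..<M}"
  have I: "finite I" "real (card I) = y * real M"
    using S by (auto simp: I_def y_def card_cartesian_product)
  have w_bounds: "3 * q ^ j \<le> real (w (t, u, j))" "real (w (t, u, j)) \<le> 3 * q ^ j + 1" for t u j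
    using q1 unfolding w_def prod.case by (simp_all add: of_nat_nat)
  have a_in: "a t \<in> rspace d" for t
    using d by (auto simp: a_def topspace_Euclidean_space)
  have f_in: "f p \<in> rspace d" if "p \<in> I" for p
    using that Ssph a_in
    by (fastforce simp: I_def f_def unit_sphere_def topspace_Euclidean_space)
  have fa: "edist d (f (t, u, j)) (a t) = r j" if "u \<in> S" for t u j
    unfolding f_def prod.case using r[of j] Ssph[OF that]
    by (intro edist_add_scaled) auto
  have wsum: "(\<Sum>p\<in>I. w p) \<le> n"
  proof -
    have "real (\<Sum>p\<in>I. w p) \<le> (\<Sum>p\<in>I. 4 * q ^ M)"
      unfolding of_nat_sum
    proof (rule sum_mono)
      fix p assume "p \<in> I"
      then obtain t u j where p: "p = (t, u, j)" "j < M" by (auto simp: I_def)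
      have "q ^ j \<le> q ^ M" "1 \<le> q ^ M" using q1 p(2) by (auto intro: power_increasing)
      then show "real (w p) \<le> 4 * q ^ M" using w_bounds(2)[of t u j] p(1) by simp
    qed
    also have "\<dots> = 4 * y * real M * q ^ M" by (simp add: I)
    finally show ?thesis using M(2) by linarith
  qed
  \<comment> \<open>By \<open>wsum\<close> the subtraction is not truncated, so \<open>X\<close> has
    exactly \<open>n\<close> points. Since \<open>a 0\<close> is among the \<open>k\<close> origins,
    the surplus adds nothing to the upper bound \<open>opt\<close>.\<close>
  define Z where "Z = replicate_mset (n - (\<Sum>p\<in>I. w p)) (a 0)"
  define X where "X = (\<Sum>p\<in>I. replicate_mset (w p) (f p)) + Z"
  have X_in: "set_mset X \<subseteq> rspace d"
    using f_in a_in I(1) by (auto simp: X_def Z_def set_mset_sum split: if_splits)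
  have X_size: "size X = n" using wsum by (simp add: X_def Z_def)
  have opt: "kmedian_opt d k X \<le> 4 * (y * real M)"
  proof -
    have "inj_on a {..<k}" by (rule inj_onI) (drule fun_cong[of _ _ 0], simp add: a_def)
    then have "kmedian_opt d k X \<le> kmedian_cost d (a ` {..<k}) X"
      using a_in k by (intro kmedian_opt_le) (auto simp: card_image)
    also have "\<dots> = (\<Sum>p\<in>I. real (w p) * Min ((\<lambda>c. edist d (f p) c) ` a ` {..<k}))
        + real (n - (\<Sum>p\<in>I. w p)) * Min ((\<lambda>c. edist d (a 0) c) ` a ` {..<k})"
      by (simp add: X_def Z_def kmedian_cost_add kmedian_cost_sum kmedian_cost_replicate)
    also have "\<dots> \<le> (\<Sum>p\<in>I. 4) + real (n - (\<Sum>p\<in>I. w p)) * 0"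
    proof (intro add_mono sum_mono mult_left_mono)
      have "Min ((\<lambda>c. edist d (a 0) c) ` a ` {..<k}) \<le> edist d (a 0) (a 0)"
        using k by (intro Min_le) auto
      then show "Min ((\<lambda>c. edist d (a 0) c) ` a ` {..<k}) \<le> 0"
        by (simp add: edist_def L2_set_def)
    next
      fix p assume "p \<in> I"
      then obtain t u j where p: "p = (t, u, j)" "t < k" "u \<in> S" by (auto simp: I_def)
      have "Min ((\<lambda>c. edist d (f p) c) ` a ` {..<k}) \<le> edist d (f p) (a t)"
        using p by (intro Min_le) auto
      also have "\<dots> = r j" using fa p by simp
      finally have "real (w p) * Min ((\<lambda>c. edist d (f p) c) ` a ` {..<k}) \<le> (3 * q ^ j + 1) * r j"
        using w_bounds(2)[of t u j] p k q1 by (intro mult_mono Min_edist_nonneg) auto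
      also have "\<dots> = 3 + r j" using q1 by (simp add: r_def field_simps)
      also have "\<dots> \<le> 4" using r by simp
      finally show "real (w p) * Min ((\<lambda>c. edist d (f p) c) ` a ` {..<k}) \<le> 4" .
    qed simp
    also have "\<dots> = 4 * (y * real M)" by (simp add: I)
    finally show ?thesis .
  qed
  have sep: "\<rho> p + \<rho> p' \<le> edist d (f p) (f p')" if "p \<in> I" "p' \<in> I" "p \<noteq> p'" for p p'
  proof -
    obtain t u j t' v j' where p: "p = (t, u, j)" "p' = (t', v, j')" "u \<in> S" "v \<in> S"
      using \<open>p \<in> I\<close> \<open>p' \<in> I\<close> by (auto simp: I_def)
    show ?thesis
    proof (cases "t = t'")
      case True
      have step: "(1 + 4 * \<epsilon>) * r m' \<le> r m" if "m < m'" for m m'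
      proof -
        have "q ^ Suc m \<le> q ^ m'" using q1 that by (intro power_increasing) auto
        then show ?thesis unfolding q_def[symmetric] using q1 by (simp add: r_def field_simps)
      qed
      have "u \<noteq> v \<or> j < j' \<or> j' < j" using True p \<open>p \<noteq> p'\<close> by auto
      then have "u \<noteq> v \<or> (1 + 4 * \<epsilon>) * r j' \<le> r j \<or> (1 + 4 * \<epsilon>) * r j \<le> r j'"
        using step by blast
      then show ?thesis
        using scaled_packing_separated[OF \<epsilon> S(2) p(3,4) r(1) r(1)] True p
        by (simp add: \<rho>_def f_def edist_add_left)
    next
      case False
      have "10 \<le> \<bar>a t 0 - a t' 0\<bar>" using False by (simp add: a_def)
      also have "\<dots> \<le> edist d (a t) (a t')" using d by (intro edist_coordinate_le) auto
      also have "\<dots> \<le> edist d (f p) (a t) + edist d (f p) (f p') + edist d (f p') (a t')"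
        using edist_triangle[of d "a t" "a t'" "f p"] edist_triangle[of d "f p" "a t'" "f p'"]
        by (simp add: edist_commute)
      also have "\<dots> \<le> 1 + edist d (f p) (f p') + 1"
        using fa p r by (intro add_mono) auto
      finally have "8 \<le> edist d (f p) (f p')" by simp
      moreover have "\<rho> p \<le> 3/2 * 1 * 1" "\<rho> p' \<le> 3/2 * 1 * 1"
        unfolding p(1,2) \<rho>_def prod.case using \<epsilon> r by (intro mult_mono; simp add: less_imp_le)+
      ultimately show ?thesis by linarith
    qed
  qed
  have wr: "9/2 * \<epsilon> \<le> real (w p) * \<rho> p" if "p \<in> I" for p
  proof -
    obtain t u j where p: "p = (t, u, j)" by (cases p)
    have "9/2 * \<epsilon> = 3 * q ^ j * \<rho> p" using q1 by (simp add: p \<rho>_def r_def)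
    also have "\<dots> \<le> real (w p) * \<rho> p"
      using w_bounds(1)[of j t u] \<epsilon> r[of j] by (intro mult_right_mono) (auto simp: p \<rho>_def)
    finally show ?thesis .
  qed
  have "1/144 * (real P * real k * ln (real n) / \<epsilon>) \<le> real (card \<xi>)"
    if \<xi>: "finite \<xi>" "\<xi> \<noteq> {}" "kmedian_cost d \<xi> X \<le> \<epsilon> * kmedian_opt d k X" for \<xi>
  proof -
    have "kmedian_cost d \<xi> X \<le> \<epsilon> * (4 * (y * real M))"
      using \<xi>(3) opt \<epsilon> by (meson mult_left_mono less_imp_le order_trans)
    then have "real (card I) - \<epsilon> * (4 * (y * real M)) / (9/2 * \<epsilon>) \<le> real (card \<xi>)"
      using \<epsilon>(1) unfolding X_def
      by (intro card_centres_ge[where \<rho> = \<rho> and f = f and w = w] I(1) \<xi>(1,2))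
        (erule sep wr | simp)+
    \<comment> \<open>The subtracted quotient is 8/9 of the number of sites. The remaining 1/9,
      times the 1/16 from the bound on \<open>M\<close>, is the constant 1/144.\<close>
    then have "1/9 * (y * real M) \<le> real (card \<xi>)" using \<epsilon> I by (simp add: field_simps)
    moreover have "y * (ln (real n) / (16 * \<epsilon>)) \<le> y * real M"
      using M(1) y1 by (intro mult_left_mono) auto
    ultimately show ?thesis by (simp add: y_def)
  qed
  then show ?case using X_in X_size unfolding P_def by blast
qed

end
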